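(* Let $X$ be a finite set with $|X|=n\geq 2$, let $\tau$ be the discrete topology on $X$, and let $G_\tau$ be the discrete topological graph of $X$. Then: (1) the clique number of $G_\tau$ is $n$; (2) the number of pendant vertices of $G_\tau$ is $n$.
   Context: For a non-empty set $X$ with the discrete topology $\tau$ (so $\tau$ is the family of all subsets of $X$), the discrete topological graph $G_\tau=(V,E)$ is the simple undirected graph with vertex set $V=\{A\in\tau : A\neq\emptyset,\ A\neq X\}$ in which two vertices $A,B$ are adjacent if and only if $A\cap B=\emptyset$. The clique number is the largest order of a complete subgraph. A pendant vertex is a vertex of degree $1$. *)

theory Defs
  imports "HOL-Analysis.Abstract_Topology" "Graph_Theory.Graph_Theory"
begin

text \<open>
  An undirected simple graph is represented, as usual in \<open>Graph_Theory\<close>, by a symmetric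
  loop-free digraph without parallel arcs (locale \<open>graph\<close>): an edge is a pair of opposite arcs.
\<close>

definition topological_graph :: "'a topology \<Rightarrow> 'a set pair_pre_digraph" where
  "topological_graph T =
     (let V = {A. openin T A \<and> A \<noteq> {} \<and> A \<noteq> topspace T}
      in \<lparr> pverts = V, parcs = {(A, B). A \<in> V \<and> B \<in> V \<and> A \<inter> B = {}} \<rparr>)"

definition discrete_topological_graph :: "'a set \<Rightarrow> 'a set pair_pre_digraph" where
  "discrete_topological_graph X = topological_graph (discrete_topology X)"

text \<open>
  Meaningful for finite graphs only: \<open>Max\<close> is unspecified on infinite sets. The set of orders is
  never empty, as the graph without vertices is complete of order 0.
\<close>

definition clique_number :: "('a, 'b) pre_digraph \<Rightarrow> nat" where
  "clique_number G = Max {k. \<exists>H. subgraph H G \<and> complete_digraph k H}"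

text \<open>
  In a symmetric digraph the out-degree of a vertex is its degree in the undirected sense.
\<close>

definition pendant_vertices :: "('a, 'b) pre_digraph \<Rightarrow> 'a set" where
  "pendant_vertices G = {v \<in> verts G. out_degree G v = 1}"

lemma graph_discrete_topological_graph:
  assumes "finite X"
  shows "graph (with_proj (discrete_topological_graph X))"
proof -
  let ?G = "discrete_topological_graph X"
  have fin: "finite (pverts ?G)"
    by (rule finite_subset[of _ "Pow X"])
      (use assms in \<open>auto simp: discrete_topological_graph_def topological_graph_def\<close>)
  have "finite (parcs ?G)"
    by (rule finite_subset[of _ "pverts ?G \<times> pverts ?G"])
      (use fin in \<open>auto simp: discrete_topological_graph_def topological_graph_def Let_def\<close>)
  with fin interpret pair_graph ?G
    by unfold_locales
      (auto simp: discrete_topological_graph_def topological_graph_def Let_def symmetric_def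
        intro!: symI)
  show ?thesis
    by unfold_locales
qed

end

theory Submission
  imports Defs "HOL-Library.Disjoint_Sets"
begin

text \<open>
  The vertices are the proper non-empty subsets of \<open>X\<close>, adjacent when disjoint. A clique is thus a
  family of pairwise disjoint non-empty subsets of \<open>X\<close>: such a family injects into \<open>X\<close> by choosing
  a point in each member, so it has at most \<open>n\<close> members, and the family of all singletons attains
  this bound (singletons are proper because \<open>n \<ge> 2\<close>).

  The neighbours of a vertex \<open>A\<close> are exactly the non-empty subsets of \<open>X - A\<close>, so its degree is
  \<open>2 ^ card (X - A) - 1\<close>. This is \<open>1\<close> precisely when \<open>X - A\<close> is a single point, and the sets
  \<open>X - {x}\<close> are as many as the points \<open>x\<close>.
\<close>

lemma pverts_discrete:
  "pverts (discrete_topological_graph X) = {A. A \<subseteq> X \<and> A \<noteq> {} \<and> A \<noteq> X}"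
  by (simp add: discrete_topological_graph_def topological_graph_def Let_def)

lemma parcs_discrete:
  "(A, B) \<in> parcs (discrete_topological_graph X) \<longleftrightarrow>
    A \<in> pverts (discrete_topological_graph X) \<and>
    B \<in> pverts (discrete_topological_graph X) \<and> A \<inter> B = {}"
  by (simp add: discrete_topological_graph_def topological_graph_def Let_def)

text \<open>
  This passes from complete subgraphs to cliques as plain vertex sets; conversely, a clique becomes
  a subgraph by taking all pairs of distinct members as arcs.
\<close>

lemma complete_subgraph_iff_clique:
  assumes "wf_digraph (with_proj G)"
  shows "(\<exists>H. subgraph H (with_proj G) \<and> complete_digraph k H) \<longleftrightarrow>
    (\<exists>S \<subseteq> pverts G. finite S \<and> card S = k \<and> (\<forall>u\<in>S. \<forall>v\<in>S. u \<noteq> v \<longrightarrow> (u, v) \<in> parcs G))"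
    (is "?L \<longleftrightarrow> ?R")
proof
  assume ?L
  then obtain H where sub: "subgraph H (with_proj G)" and comp: "complete_digraph k H"
    by blast
  interpret H: graph H
    using comp by (simp add: complete_digraph_def)
  have "arcs_ends H \<subseteq> parcs G"
    using sub by (auto simp: subgraph_def compatible_def arcs_ends_conv)
  moreover have "verts H \<subseteq> pverts G"
    using sub by (simp add: subgraph_def)
  moreover have "card (verts H) = k"
    and "arcs_ends H = {(u, v). (u, v) \<in> verts H \<times> verts H \<and> u \<noteq> v}"
    using comp by (simp_all add: complete_digraph_def)
  ultimately show ?R
    using H.finite_verts by (intro exI[of _ "verts H"]) auto
next
  assume ?R
  then obtain S where S: "S \<subseteq> pverts G" "finite S" "card S = k"
    and clique: "\<forall>u\<in>S. \<forall>v\<in>S. u \<noteq> v \<longrightarrow> (u, v) \<in> parcs G"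
    by blast
  define K where "K = \<lparr>pverts = S, parcs = {(u, v). (u, v) \<in> S \<times> S \<and> u \<noteq> v}\<rparr>"
  have comp: "complete_digraph k (with_proj K)"
    using S by (simp add: complete_digraph_pair_def K_def)
  then interpret K: graph "with_proj K"
    by (simp add: complete_digraph_def)
  have "subgraph (with_proj K) (with_proj G)"
    using S clique assms K.wf_digraph
    by (auto simp: subgraph_def compatible_def K_def)
  with comp show ?L by blast
qed

text \<open>
  A point chosen in each member determines that member, as no point lies in two of them.
\<close>

lemma card_disjoint_nonempty_le:
  assumes "finite X" and "S \<subseteq> Pow X" and "disjoint S" and "{} \<notin> S"
  shows "card S \<le> card X"
proof -
  define f where "f A = (SOME x. x \<in> A)" for A :: "'a set"
  have f: "f A \<in> A" if "A \<in> S" for A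
    using that assms(4) unfolding f_def by (metis some_in_eq)
  have "inj_on f S"
    using f assms(3) by (intro inj_onI) (metis disjointD disjoint_iff)
  moreover have "f ` S \<subseteq> X"
    using f assms(2) by blast
  ultimately show ?thesis
    using assms(1) by (rule card_inj_on_le)
qed

lemma clique_number_discrete:
  assumes "finite X" and "card X \<ge> 2"
  shows "clique_number (with_proj (discrete_topological_graph X)) = card X"
proof -
  let ?G = "discrete_topological_graph X"
  interpret G: graph "with_proj ?G"
    using assms(1) by (rule graph_discrete_topological_graph)
  let ?orders = "{k. \<exists>H. subgraph H (with_proj ?G) \<and> complete_digraph k H}"
  note iff = complete_subgraph_iff_clique[OF G.wf_digraph]
  have upper: "k \<le> card X" if "k \<in> ?orders" for k
  proof -
    from that obtain S where S: "S \<subseteq> pverts ?G" "card S = k"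
      and clique: "\<forall>A\<in>S. \<forall>B\<in>S. A \<noteq> B \<longrightarrow> (A, B) \<in> parcs ?G"
      unfolding iff by blast
    have "disjoint S"
      using clique by (intro disjointI) (simp add: parcs_discrete)
    moreover have "S \<subseteq> Pow X" "{} \<notin> S"
      using S by (auto simp: pverts_discrete)
    ultimately show ?thesis
      using card_disjoint_nonempty_le[OF assms(1)] S(2) by blast
  qed
  have attained: "card X \<in> ?orders"
    unfolding iff mem_Collect_eq
  proof (intro exI conjI)
    let ?S = "(\<lambda>x. {x}) ` X"
    show sub: "?S \<subseteq> pverts ?G"
      using assms(2) by (auto simp: pverts_discrete)
    show "finite ?S"
      using assms(1) by simp
    show "card ?S = card X"
      by (simp add: card_image)
    show "\<forall>A\<in>?S. \<forall>B\<in>?S. A \<noteq> B \<longrightarrow> (A, B) \<in> parcs ?G"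
      using sub by (auto simp: parcs_discrete)
  qed
  have "finite ?orders"
    unfolding finite_nat_set_iff_bounded_le using upper by blast
  then show ?thesis
    unfolding clique_number_def using upper attained by (rule Max_eqI)
qed

text \<open>
  A non-empty subset of \<open>X - A\<close> is never all of \<open>X\<close>, since \<open>A\<close> is non-empty; so each of
  them is a vertex, and the empty set alone is left out of the count.
\<close>

lemma out_degree_discrete:
  assumes "finite X" and "A \<in> pverts (discrete_topological_graph X)"
  shows "out_degree (with_proj (discrete_topological_graph X)) A = 2 ^ card (X - A) - 1"
proof -
  have "out_arcs (with_proj (discrete_topological_graph X)) A = {A} \<times> (Pow (X - A) - {{}})"
    using assms(2) by (auto simp: out_arcs_def parcs_discrete) (auto simp: pverts_discrete)
  then show ?thesis
    using assms(1)
    by (simp add: out_degree_def card_cartesian_product card_Diff_singleton card_Pow)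
qed

lemma pendant_vertices_discrete:
  assumes "finite X" and "card X \<ge> 2"
  shows "pendant_vertices (with_proj (discrete_topological_graph X)) = (\<lambda>x. X - {x}) ` X"
proof -
  let ?V = "pverts (discrete_topological_graph X)"
  have "(2::nat) ^ m - 1 = 1 \<longleftrightarrow> m = 1" for m
    using power_inject_exp[of "2::nat" m 1] by (auto simp del: power_inject_exp)
  then have degree_one: "out_degree (with_proj (discrete_topological_graph X)) A = 1
      \<longleftrightarrow> card (X - A) = 1" if "A \<in> ?V" for A
    using out_degree_discrete[OF assms(1) that] by simp
  moreover have "A \<in> ?V \<and> card (X - A) = 1 \<longleftrightarrow> (\<exists>x\<in>X. A = X - {x})" for A
  proof
    assume "A \<in> ?V \<and> card (X - A) = 1"
    then obtain x where "A \<subseteq> X" "X - A = {x}"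
      by (auto simp: pverts_discrete card_1_singleton_iff)
    then show "\<exists>x\<in>X. A = X - {x}"
      by blast
  next
    assume "\<exists>x\<in>X. A = X - {x}"
    then obtain x where x: "x \<in> X" "A = X - {x}"
      by blast
    then have "card A = card X - 1"
      using assms(1) by simp
    then have "A \<noteq> {}"
      using assms(2) by auto
    moreover have "X - A = {x}"
      using x by blast
    ultimately show "A \<in> ?V \<and> card (X - A) = 1"
      using x by (auto simp: pverts_discrete)
  qed
  ultimately show ?thesis
    unfolding pendant_vertices_def with_proj_simps by blast
qed

theorem proposition2p3:
  fixes X :: "'a set" and n :: nat
  assumes "finite X" and "card X = n" and "n \<ge> 2"
  shows "clique_number (with_proj (discrete_topological_graph X)) = n
    \<and> card (pendant_vertices (with_proj (discrete_topological_graph X))) = n"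
proof -
  have "inj_on (\<lambda>x. X - {x}) X"
    by (rule inj_onI) blast
  then have "card ((\<lambda>x. X - {x}) ` X) = n"
    using assms(2) by (simp add: card_image)
  then show ?thesis
    using assms clique_number_discrete pendant_vertices_discrete by metis
qed

end
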